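(* Let $G$ be a graph and let $X, Y \subseteq V(G)$ be (not necessarily disjoint) vertex subsets with $X$ nonempty, such that $X$ is $Y$-identifiable. Then there is an $(X,Y)$-separating set in $G$ of size at most $|X|-1$, and there is an $(X,Y)$-identifying code of $G$ of size at most $|X|$.
   Context: All graphs are finite, simple, undirected and loopless. $N_G[u]$ denotes the closed neighborhood of $u$ in $G$. A vertex $w$ separates two distinct vertices $u,v$ if $w$ belongs to exactly one of $N_G[u]$ and $N_G[v]$. For $X,Y \subseteq V(G)$, an $(X,Y)$-separating set is a set $C \subseteq Y$ such that every pair of distinct vertices of $X$ is separated by some vertex of $C$, i.e. $N_G[u]\cap C \ne N_G[v] \cap C$ for all distinct $u,v \in X$. An $(X,Y)$-identifying code is an $(X,Y)$-separating set $C \subseteq Y$ that moreover dominates $X$, i.e. $N_G[u] \cap C \neq \emptyset$ for every $u \in X$. The set $X$ is called $Y$-identifiable if an $(X,Y)$-identifying code of $G$ exists (equivalently, if $Y$ itself is an $(X,Y)$-identifying code). *)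

theory Defs
  imports "Graph_Theory.Digraph"
begin

text \<open>
  The locale predicate \<^const>\<open>graph\<close> describes finite loopless symmetric digraphs without
  multiple arcs, i.e. finite simple undirected graphs; each edge is a pair of opposite arcs.
  The notions below are meant for such \<open>G\<close> only.
\<close>

definition closed_neighborhood :: "('a, 'b) pre_digraph \<Rightarrow> 'a \<Rightarrow> 'a set" where
  "closed_neighborhood G u = insert u {w. u \<rightarrow>\<^bsub>G\<^esub> w}"

definition separates :: "('a, 'b) pre_digraph \<Rightarrow> 'a \<Rightarrow> 'a \<Rightarrow> 'a \<Rightarrow> bool" where
  "separates G w u v \<longleftrightarrow> (w \<in> closed_neighborhood G u) \<noteq> (w \<in> closed_neighborhood G v)"

definition separating_set :: "('a, 'b) pre_digraph \<Rightarrow> 'a set \<Rightarrow> 'a set \<Rightarrow> 'a set \<Rightarrow> bool" where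
  "separating_set G X Y C \<longleftrightarrow>
     C \<subseteq> Y \<and> (\<forall>u\<in>X. \<forall>v\<in>X. u \<noteq> v \<longrightarrow> (\<exists>w\<in>C. separates G w u v))"

definition identifying_code :: "('a, 'b) pre_digraph \<Rightarrow> 'a set \<Rightarrow> 'a set \<Rightarrow> 'a set \<Rightarrow> bool" where
  "identifying_code G X Y C \<longleftrightarrow>
     separating_set G X Y C \<and> (\<forall>u\<in>X. closed_neighborhood G u \<inter> C \<noteq> {})"

definition identifiable :: "('a, 'b) pre_digraph \<Rightarrow> 'a set \<Rightarrow> 'a set \<Rightarrow> bool" where
  "identifiable G X Y \<longleftrightarrow> (\<exists>C. identifying_code G X Y C)"

lemma separating_set_iff:
  "separating_set G X Y C \<longleftrightarrow>
     C \<subseteq> Y \<and> (\<forall>u\<in>X. \<forall>v\<in>X. u \<noteq> v \<longrightarrow>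
       closed_neighborhood G u \<inter> C \<noteq> closed_neighborhood G v \<inter> C)"
  unfolding separating_set_def separates_def by blast

lemma identifiable_iff: "identifiable G X Y \<longleftrightarrow> identifying_code G X Y Y"
  unfolding identifiable_def identifying_code_def separating_set_def by blast

end

theory Submission
  imports Defs
begin

text \<open>
  Build the separating set by adding the vertices of \<open>X\<close> one at a time. If \<open>C\<close> separates the
  vertices treated so far, their traces on \<open>C\<close> are pairwise different, so a new vertex shares its
  trace with at most one of them, and one further element of \<open>Y\<close> suffices. For the same reason at
  most one vertex of \<open>X\<close> is left undominated at the end, and one more element dominates it.
\<close>

text \<open>This is Bondy's theorem on induced subsets, for the family of sets \<open>N u\<close>
  traced on \<open>Y\<close>. The strict bound starts at 0 < 1 for a single vertex and avoids
  truncated subtraction.\<close>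

lemma exists_inj_on_traces:
  fixes N :: "'a \<Rightarrow> 'c set"
  assumes "finite X" and "X \<noteq> {}" and "inj_on (\<lambda>u. N u \<inter> Y) X"
  shows "\<exists>C\<subseteq>Y. finite C \<and> inj_on (\<lambda>u. N u \<inter> C) X \<and> card C < card X"
  using assms
proof (induction X rule: finite_ne_induct)
  case (singleton x)
  show ?case by (intro exI[of _ "{}"]) simp
next
  case (insert x X)
  from insert.IH insert.prems obtain C where C: "C \<subseteq> Y" "finite C"
      "inj_on (\<lambda>u. N u \<inter> C) X" "card C < card X"
    by (auto simp: inj_on_insert)
  show ?case
  proof (cases "\<exists>v\<in>X. N v \<inter> C = N x \<inter> C")
    case False
    then have "inj_on (\<lambda>u. N u \<inter> C) (insert x X)"
      using C(3) by (auto simp: inj_on_insert)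
    then show ?thesis
      using C insert.hyps by (intro exI[of _ C]) simp
  next
    case True
    then obtain v where v: "v \<in> X" "N v \<inter> C = N x \<inter> C" by blast
    \<comment> \<open>\<open>x\<close> is new, so \<open>v\<close> and \<open>x\<close> are distinct
      and \<open>Y\<close> must tell them apart.\<close>
    have "N v \<inter> Y \<noteq> N x \<inter> Y"
      using insert.prems insert.hyps v(1) by (auto simp: inj_on_def)
    then obtain w where w: "w \<in> Y" "(w \<in> N v) \<noteq> (w \<in> N x)" by blast
    \<comment> \<open>Enlarging \<open>C\<close> only refines traces, so pairs already separated
      stay separated.\<close>
    have old: "N a \<inter> C = N b \<inter> C" if "N a \<inter> insert w C = N b \<inter> insert w C" for a b
      using that by blast
    have "inj_on (\<lambda>u. N u \<inter> insert w C) X"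
      using C(3) old unfolding inj_on_def by blast
    moreover have "N u \<inter> insert w C \<noteq> N x \<inter> insert w C" if "u \<in> X" for u
    proof
      assume eq: "N u \<inter> insert w C = N x \<inter> insert w C"
      \<comment> \<open>By injectivity on \<open>C\<close>, \<open>v\<close> is the only old vertex
        that shares the trace of \<open>x\<close>, and \<open>w\<close> was chosen to separate
        exactly this pair.\<close>
      then have "u = v"
        using old[OF eq] v C(3) that by (auto simp: inj_on_def)
      then show False
        using eq w(2) by blast
    qed
    ultimately have "inj_on (\<lambda>u. N u \<inter> insert w C) (insert x X)"
      by (auto simp: inj_on_insert)
    moreover have "card (insert w C) < card (insert x X)"
      using C insert.hyps by (simp add: card_insert_if)
    ultimately show ?thesis
      using C w(1) by (intro exI[of _ "insert w C"]) simp
  qed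
qed

lemma separating_set_iff_inj_on:
  "separating_set G X Y C \<longleftrightarrow> C \<subseteq> Y \<and> inj_on (\<lambda>u. closed_neighborhood G u \<inter> C) X"
  unfolding separating_set_iff inj_on_def by blast

lemma separating_set_mono:
  "separating_set G X Y C \<Longrightarrow> C \<subseteq> D \<Longrightarrow> D \<subseteq> Y \<Longrightarrow> separating_set G X Y D"
  unfolding separating_set_def by blast

lemma separating_set_extend_identifying_code:
  assumes sep: "separating_set G X Y C"
    and dom: "\<And>u. u \<in> X \<Longrightarrow> closed_neighborhood G u \<inter> Y \<noteq> {}"
  shows "\<exists>D. identifying_code G X Y D \<and> card D \<le> Suc (card C)"
proof (cases "\<exists>u\<in>X. closed_neighborhood G u \<inter> C = {}")
  case False
  then show ?thesis
    using sep by (intro exI[of _ C]) (auto simp: identifying_code_def)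
next
  case True
  then obtain u where u: "u \<in> X" "closed_neighborhood G u \<inter> C = {}" by blast
  obtain w where w: "w \<in> closed_neighborhood G u" "w \<in> Y"
    using dom[OF u(1)] by blast
  have "closed_neighborhood G v \<inter> insert w C \<noteq> {}" if "v \<in> X" for v
  proof (cases "v = u")
    case False
    \<comment> \<open>Otherwise \<open>u\<close> and \<open>v\<close> would both have the empty
      trace on \<open>C\<close>.\<close>
    then have "closed_neighborhood G v \<inter> C \<noteq> {}"
      using sep u that unfolding separating_set_iff by metis
    then show ?thesis by blast
  qed (use w(1) in blast)
  moreover have "separating_set G X Y (insert w C)"
    using separating_set_mono[OF sep, of "insert w C"] sep w(2)
    by (auto simp: separating_set_def)
  ultimately have "identifying_code G X Y (insert w C)"
    by (simp add: identifying_code_def)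
  \<comment> \<open>For infinite \<open>C\<close> both cardinalities are 0, so the bound holds there
    too.\<close>
  moreover have "card (insert w C) \<le> Suc (card C)"
    by (rule card_insert_le_m1[of "Suc (card C)", simplified]) simp_all
  ultimately show ?thesis by blast
qed

theorem lemma4:
  fixes G :: "('a, 'b) pre_digraph" and X Y :: "'a set"
  assumes "graph G"
    and "X \<subseteq> verts G" and "Y \<subseteq> verts G" and "X \<noteq> {}"
    and "identifiable G X Y"
  shows "(\<exists>C. separating_set G X Y C \<and> card C \<le> card X - 1) \<and>
         (\<exists>C. identifying_code G X Y C \<and> card C \<le> card X)"
proof -
  interpret graph G by fact
  have "finite X"
    using assms(2) finite_verts by (rule finite_subset)
  have code: "identifying_code G X Y Y"
    using assms(5) by (simp add: identifiable_iff)
  then have "inj_on (\<lambda>u. closed_neighborhood G u \<inter> Y) X"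
    by (simp add: identifying_code_def separating_set_iff_inj_on)
  from exists_inj_on_traces[OF \<open>finite X\<close> assms(4) this]
  obtain C where C: "separating_set G X Y C" "card C < card X"
    by (auto simp: separating_set_iff_inj_on)
  obtain D where "identifying_code G X Y D" "card D \<le> Suc (card C)"
    using separating_set_extend_identifying_code[OF C(1)] code
    by (auto simp: identifying_code_def)
  \<comment> \<open>The slack in \<open>card C < card X\<close> pays for the one dominating vertex
    that \<open>D\<close> may add.\<close>
  with C show ?thesis
    by (intro conjI exI[of _ C] exI[of _ D]) auto
qed

end
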